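(* Let $a,b,c$ be integers and $r,s,t$ real numbers, let $(V_n)_{n\ge 0}$ be the associated generalized Tribonacci sequence, and let $\varphi_n$ be the $n$th generalized Tribonacci hyperbolic spinor. Then for all $n>0$, $$\begin{bmatrix}\varphi_{n+2}\\ \varphi_{n+1}\\ \varphi_n\end{bmatrix}=\begin{bmatrix} r&s&t\\1&0&0\\0&1&0\end{bmatrix}^n\begin{bmatrix}\varphi_2\\ \varphi_1\\ \varphi_0\end{bmatrix}.$$
   Context: Hyperbolic numbers are the elements $x+yj$ with $x,y\in\mathbb{R}$ and $j^2=1$ (a commutative ring). A hyperbolic spinor is a column vector with two hyperbolic number components; addition and scalar multiplication are componentwise. Given integers $a,b,c$ and real numbers $r,s,t$, the generalized Tribonacci sequence $(V_n)_{n\ge0}$ is defined by $V_0=a$, $V_1=b$, $V_2=c$ and $V_n=rV_{n-1}+sV_{n-2}+tV_{n-3}$ for $n\ge 3$. The $n$th generalized Tribonacci hyperbolic spinor is $\varphi_n=\begin{bmatrix} V_n+V_{n+3}j\\ -V_{n+1}+V_{n+2}j\end{bmatrix}$, $n\ge 0$. A real $3\times 3$ matrix acts on a column of three spinors in the usual way, each real entry acting on a spinor by scalar multiplication. *)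

theory Defs
  imports "HOL-Analysis.Analysis"
begin

text \<open>\<open>Hyperbolic x y\<close> is the hyperbolic number $x + yj$ with $j^2 = 1$.\<close>

datatype hyperbolic = Hyperbolic (hre: real) (him: real)

instantiation hyperbolic :: "{comm_ring_1, real_algebra_1}"
begin

definition zero_hyperbolic :: hyperbolic where
  "0 = Hyperbolic 0 0"

definition one_hyperbolic :: hyperbolic where
  "1 = Hyperbolic 1 0"

definition plus_hyperbolic :: "hyperbolic \<Rightarrow> hyperbolic \<Rightarrow> hyperbolic" where
  "z + w = Hyperbolic (hre z + hre w) (him z + him w)"

definition uminus_hyperbolic :: "hyperbolic \<Rightarrow> hyperbolic" where
  "- z = Hyperbolic (- hre z) (- him z)"

definition minus_hyperbolic :: "hyperbolic \<Rightarrow> hyperbolic \<Rightarrow> hyperbolic" where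
  "z - w = Hyperbolic (hre z - hre w) (him z - him w)"

definition times_hyperbolic :: "hyperbolic \<Rightarrow> hyperbolic \<Rightarrow> hyperbolic" where
  "z * w = Hyperbolic (hre z * hre w + him z * him w) (hre z * him w + him z * hre w)"

definition scaleR_hyperbolic :: "real \<Rightarrow> hyperbolic \<Rightarrow> hyperbolic" where
  "c *\<^sub>R z = Hyperbolic (c * hre z) (c * him z)"

instance
  by standard
    (auto simp: zero_hyperbolic_def one_hyperbolic_def plus_hyperbolic_def uminus_hyperbolic_def
      minus_hyperbolic_def times_hyperbolic_def scaleR_hyperbolic_def algebra_simps)

end

definition hyp_j :: hyperbolic where
  "hyp_j = Hyperbolic 0 1"

lemma hyp_j_squared: "hyp_j ^ 2 = 1"
  by (simp add: power2_eq_square hyp_j_def times_hyperbolic_def one_hyperbolic_def)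

lemma Hyperbolic_eq: "Hyperbolic x y = of_real x + of_real y * hyp_j"
  by (simp add: of_real_def hyp_j_def one_hyperbolic_def scaleR_hyperbolic_def
      plus_hyperbolic_def times_hyperbolic_def)

type_synonym hyperbolic_spinor = "hyperbolic ^ 2"

fun gen_tribonacci :: "int \<Rightarrow> int \<Rightarrow> int \<Rightarrow> real \<Rightarrow> real \<Rightarrow> real \<Rightarrow> nat \<Rightarrow> real" where
  "gen_tribonacci a b c r s t 0 = of_int a"
| "gen_tribonacci a b c r s t (Suc 0) = of_int b"
| "gen_tribonacci a b c r s t (Suc (Suc 0)) = of_int c"
| "gen_tribonacci a b c r s t (Suc (Suc (Suc n))) =
     r * gen_tribonacci a b c r s t (Suc (Suc n)) +
     s * gen_tribonacci a b c r s t (Suc n) +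
     t * gen_tribonacci a b c r s t n"

definition tribonacci_spinor ::
    "int \<Rightarrow> int \<Rightarrow> int \<Rightarrow> real \<Rightarrow> real \<Rightarrow> real \<Rightarrow> nat \<Rightarrow> hyperbolic_spinor" where
  "tribonacci_spinor a b c r s t n =
     (let V = gen_tribonacci a b c r s t in
      vector [of_real (V n) + of_real (V (n + 3)) * hyp_j,
              - of_real (V (n + 1)) + of_real (V (n + 2)) * hyp_j])"

text \<open>The library's \<open>*\<close> and \<open>^\<close> on matrices are entrywise, so powers with respect to the
  matrix product \<open>**\<close> are defined here.\<close>

primrec mat_power :: "'a::semiring_1 ^ 'n ^ 'n \<Rightarrow> nat \<Rightarrow> 'a ^ 'n ^ 'n" where
  "mat_power A 0 = mat 1"
| "mat_power A (Suc n) = A ** mat_power A n"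

text \<open>A real matrix acting on a column with entries in a real vector space; \<open>*v\<close> requires
  matrix and column entries of the same type.\<close>

definition mat_scaleR :: "real ^ 'n ^ 'm \<Rightarrow> 'a::real_vector ^ 'n \<Rightarrow> 'a ^ 'm" where
  "mat_scaleR A x = (\<chi> i. \<Sum>k\<in>UNIV. A $ i $ k *\<^sub>R x $ k)"

definition tribonacci_matrix :: "real \<Rightarrow> real \<Rightarrow> real \<Rightarrow> real ^ 3 ^ 3" where
  "tribonacci_matrix r s t = vector [vector [r, s, t], vector [1, 0, 0], vector [0, 1, 0]]"

end

theory Submission
  imports Defs
begin

text \<open>
  The components of a spinor are fixed linear combinations of shifts of \<open>V\<close>, and the recurrence of
  \<open>V\<close> is linear and invariant under shifts. So the spinors satisfy the same third-order recurrence
  as \<open>V\<close> (\<open>tribonacci_spinor_rec\<close>), which says precisely that the companion matrix moves the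
  window of three consecutive spinors one step forward. Since matrices act on columns
  of vectors (\<open>mat_scaleR_mult\<close>), \<open>n\<close> such steps amount to the action of the \<open>n\<close>-th power.
\<close>

lemma mat_scaleR_one: "mat_scaleR (mat 1) x = x"
  by (simp add: mat_scaleR_def mat_def vec_eq_iff if_distrib [of "\<lambda>c. c *\<^sub>R _"] cong: if_cong)

text \<open>Associativity of the action: exchange the two sums.\<close>

lemma mat_scaleR_mult:
  "mat_scaleR (A ** B) x = mat_scaleR A (mat_scaleR B x)"
proof -
  have "(\<Sum>k\<in>UNIV. (\<Sum>l\<in>UNIV. A $ i $ l * B $ l $ k) *\<^sub>R x $ k) =
        (\<Sum>l\<in>UNIV. A $ i $ l *\<^sub>R (\<Sum>k\<in>UNIV. B $ l $ k *\<^sub>R x $ k))" for i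
    unfolding scaleR_sum_left scaleR_sum_right scaleR_scaleR by (rule sum.swap)
  then show ?thesis
    by (simp add: mat_scaleR_def matrix_matrix_mult_def vec_eq_iff)
qed

lemma tribonacci_matrix_action:
  "mat_scaleR (tribonacci_matrix r s t) (vector [x, y, z]) =
     vector [r *\<^sub>R x + s *\<^sub>R y + t *\<^sub>R z, x, y]"
  by (simp add: mat_scaleR_def tribonacci_matrix_def vec_eq_iff forall_3 sum_3)

lemma gen_tribonacci_rec:
  "gen_tribonacci a b c r s t (n + 3) =
     r * gen_tribonacci a b c r s t (n + 2) + s * gen_tribonacci a b c r s t (n + 1) +
     t * gen_tribonacci a b c r s t n"
  by (simp add: numeral_eq_Suc)

text \<open>Real and hyperbolic parts as explicit coordinates, so that equations between spinors split
  into equations between real numbers.\<close>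

lemma tribonacci_spinor_eq:
  "tribonacci_spinor a b c r s t n =
     (let V = gen_tribonacci a b c r s t in
      vector [Hyperbolic (V n) (V (n + 3)), Hyperbolic (- V (n + 1)) (V (n + 2))])"
  by (simp add: tribonacci_spinor_def Hyperbolic_eq Let_def)

lemma tribonacci_spinor_rec:
  "tribonacci_spinor a b c r s t (n + 3) =
     r *\<^sub>R tribonacci_spinor a b c r s t (n + 2) + s *\<^sub>R tribonacci_spinor a b c r s t (n + 1) +
     t *\<^sub>R tribonacci_spinor a b c r s t n"
proof -
  define V where "V = gen_tribonacci a b c r s t"
  have rec: "V (m + 3) = r * V (m + 2) + s * V (m + 1) + t * V m" for m
    unfolding V_def by (rule gen_tribonacci_rec)
  \<comment> \<open>The shifts occurring in \<open>\<phi>\<^sub>n\<close> range over 0, ..., 3; the recurrence is needed at each of them.\<close>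
  note recs = rec [of n] rec [of "n + 1"] rec [of "n + 2"] rec [of "n + 3"]
  show ?thesis
    using recs
    by (simp add: tribonacci_spinor_eq Let_def V_def [symmetric] vec_eq_iff forall_2
        plus_hyperbolic_def scaleR_hyperbolic_def eval_nat_numeral algebra_simps)
qed

text \<open>By induction from \<open>n = 0\<close>, where the power is the identity matrix: left multiplication by
  one more factor of the companion matrix advances the window by one index.\<close>

lemma tribonacci_spinor_mat_power:
  fixes a b c :: int and r s t :: real
  defines "\<phi> \<equiv> tribonacci_spinor a b c r s t"
  shows "(vector [\<phi> (n + 2), \<phi> (n + 1), \<phi> n] :: hyperbolic_spinor ^ 3) =
    mat_scaleR (mat_power (tribonacci_matrix r s t) n) (vector [\<phi> 2, \<phi> 1, \<phi> 0])"
proof (induction n)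
  case 0
  show ?case
    by (simp add: mat_scaleR_one numeral_2_eq_2)
next
  case (Suc n)
  have "(vector [\<phi> (Suc n + 2), \<phi> (Suc n + 1), \<phi> (Suc n)] :: hyperbolic_spinor ^ 3) =
      vector [r *\<^sub>R \<phi> (n + 2) + s *\<^sub>R \<phi> (n + 1) + t *\<^sub>R \<phi> n, \<phi> (n + 2), \<phi> (n + 1)]"
    using tribonacci_spinor_rec [of a b c r s t n] by (simp add: \<phi>_def eval_nat_numeral)
  also have "\<dots> = mat_scaleR (tribonacci_matrix r s t) (vector [\<phi> (n + 2), \<phi> (n + 1), \<phi> n])"
    by (rule tribonacci_matrix_action [symmetric])
  finally show ?case
    by (simp only: Suc.IH mat_power.simps mat_scaleR_mult)
qed

theorem theorem3p12:
  fixes a b c :: int and r s t :: real and n :: nat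
  defines "\<phi> \<equiv> tribonacci_spinor a b c r s t"
  assumes "n > 0"
  shows "(vector [\<phi> (n + 2), \<phi> (n + 1), \<phi> n] :: hyperbolic_spinor ^ 3) =
    mat_scaleR (mat_power (tribonacci_matrix r s t) n) (vector [\<phi> 2, \<phi> 1, \<phi> 0])"
  unfolding \<phi>_def by (rule tribonacci_spinor_mat_power)

end
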